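(* Let $\mu$ be a finite positive Borel measure supported on the unit circle $\mathbb T=\{z\in\mathbb C:|z|=1\}$ whose support contains infinitely many points, and let $(L_n(z))_{n\ge 0}$ be the system of monic orthogonal polynomials with respect to $\mu$. Let $\xi\in\mathbb C$ be fixed and let $k$ be a positive integer. Then, for every $n$, all the zeros of the $k$-polar polynomial $Q_{n;k}(z;\xi)$ are contained in the closed disk $$\overline{D\bigl(0,\,|\xi|+(k+1)(1+|\xi|)\bigr)}=\{z\in\mathbb C: |z|\le |\xi|+(k+1)(1+|\xi|)\}.$$
   Context: The system of monic orthogonal polynomials with respect to $\mu$ is the sequence $(L_n(z))_{n\ge 0}$, with $L_n$ monic of degree $n$, satisfying $\int_{\mathbb T} L_n(z)\, z^{-j}\,d\mu(z)=0$ for $j=0,1,\dots,n-1$ (on $\mathbb T$, $z^{-j}=\overline{z^{j}}$) and $\int_{\mathbb T} |L_n(z)|^2\,d\mu(z)\neq 0$. For a fixed $\xi\in\mathbb C$ and a positive integer $k$, the $k$-polar polynomial $Q_{n;k}(z;\xi)$ related to $\mu$ is the polynomial solution $P$ of degree $n$ of the $k$-th order linear differential equation $$\frac{d^k}{dz^k}\bigl[(z-\xi)^k P(z)\bigr]=(n+1)(n+2)\cdots(n+k)\,L_n(z).$$ *)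

theory Defs
  imports "HOL-Analysis.Analysis" "HOL-Computational_Algebra.Polynomial"
begin

definition msupport :: "'a::topological_space measure \<Rightarrow> 'a set" where
  "msupport M = {x. \<forall>U. open U \<longrightarrow> x \<in> U \<longrightarrow> emeasure M U > 0}"

text \<open>
  The measure lives on the Borel sets of the whole plane. Since the plane is second countable,
  the condition on the support says that the complement of the circle is a null set.
\<close>

definition circle_measure :: "complex measure \<Rightarrow> bool" where
  "circle_measure M \<longleftrightarrow> finite_measure M \<and> sets M = sets borel \<and> msupport M \<subseteq> sphere 0 1"

definition monic_OPS :: "complex measure \<Rightarrow> (nat \<Rightarrow> complex poly) \<Rightarrow> bool" where
  "monic_OPS M L \<longleftrightarrow>
     (\<forall>n. degree (L n) = n \<and> lead_coeff (L n) = 1 \<and>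
          (\<forall>j<n. (LINT z:sphere 0 1|M. poly (L n) z * z powi (- int j)) = 0) \<and>
          (LINT z:sphere 0 1|M. (cmod (poly (L n) z))\<^sup>2) \<noteq> 0)"

definition is_polar_poly ::
    "(nat \<Rightarrow> complex poly) \<Rightarrow> nat \<Rightarrow> complex \<Rightarrow> nat \<Rightarrow> complex poly \<Rightarrow> bool" where
  "is_polar_poly L k \<xi> n P \<longleftrightarrow>
     degree P = n \<and>
     (pderiv ^^ k) ([:- \<xi>, 1:] ^ k * P) = smult (\<Prod>i=1..k. of_nat (n + i)) (L n)"

definition polar_poly ::
    "(nat \<Rightarrow> complex poly) \<Rightarrow> nat \<Rightarrow> complex \<Rightarrow> nat \<Rightarrow> complex poly" where
  "polar_poly L k \<xi> n = (THE P. is_polar_poly L k \<xi> n P)"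

text \<open>
  The remaining lemmas show that the description defining \<open>polar_poly\<close> has exactly one solution
  (also for \<open>n = 0\<close>) whenever \<open>L n\<close> is monic of degree \<open>n\<close>.
\<close>

lemma higher_pderiv_linear_power:
  "(pderiv ^^ k) ([:- \<xi>, 1:] ^ (k + j)) =
     smult (\<Prod>i=1..k. of_nat (j + i)) ([:- \<xi>, 1::complex:] ^ j)"
proof (induction k)
  case (Suc k)
  have "pderiv ([:- \<xi>, 1:] ^ (Suc k + j)) =
          smult (of_nat (j + Suc k)) ([:- \<xi>, 1::complex:] ^ (k + j))"
    by (simp add: pderiv_power_Suc pderiv_pCons add_ac del: power_Suc)
  then have "(pderiv ^^ Suc k) ([:- \<xi>, 1:] ^ (Suc k + j)) =
          smult (of_nat (j + Suc k)) (smult (\<Prod>i=1..k. of_nat (j + i)) ([:- \<xi>, 1::complex:] ^ j))"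
    by (simp only: funpow_Suc_right o_apply higher_pderiv_smult Suc)
  then show ?case
    by (simp add: mult_ac del: funpow.simps of_nat_Suc of_nat_add)
qed simp

lemma higher_pderiv_eq_0D:
  "(pderiv ^^ k) (p :: complex poly) = 0 \<Longrightarrow> p = 0 \<or> degree p < k"
proof (induction k arbitrary: p)
  case (Suc k)
  have "pderiv p = 0 \<or> degree (pderiv p) < k"
    using Suc by (simp add: funpow_Suc_right del: funpow.simps)
  then show ?case
    by (auto simp: pderiv_eq_0_iff degree_pderiv)
qed simp

lemma is_polar_poly_unique:
  assumes "is_polar_poly L k \<xi> n P" "is_polar_poly L k \<xi> n Q"
  shows "P = Q"
proof (rule ccontr)
  assume "P \<noteq> Q"
  define w where "w = [:- \<xi>, 1::complex:]"
  have w: "w \<noteq> 0" "degree w = 1"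
    by (simp_all add: w_def)
  have diff: "(pderiv ^^ k) (p - q) = (pderiv ^^ k) p - (pderiv ^^ k) q" for p q :: "complex poly"
    by (induction k) (simp_all add: pderiv_diff)
  have "(pderiv ^^ k) (w ^ k * (P - Q)) = 0"
    using assms by (simp add: right_diff_distrib diff is_polar_poly_def w_def)
  then have "w ^ k * (P - Q) = 0 \<or> degree (w ^ k * (P - Q)) < k"
    by (rule higher_pderiv_eq_0D)
  with \<open>P \<noteq> Q\<close> w show False
    by (simp add: degree_mult_eq degree_power_eq)
qed

lemma is_polar_poly_exists:
  assumes "degree (L n) = n" "lead_coeff (L n) = 1"
  shows "\<exists>P. is_polar_poly L k \<xi> n P"
proof -
  define w where "w = [:- \<xi>, 1::complex:]"
  define q where "q = pcompose (L n) [:\<xi>, 1:]"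
  define r where "r j = (\<Prod>i=1..k. of_nat (j + i) :: complex)" for j
  define P where "P = (\<Sum>j\<le>n. smult (r n * coeff q j / r j) (w ^ j))"
  have r: "r j \<noteq> 0" for j
    by (auto simp: r_def simp del: of_nat_add)
  have w: "w \<noteq> 0" "degree (w ^ j) = j" "coeff (w ^ j) j = 1" for j
  proof -
    show "w \<noteq> 0" by (simp add: w_def)
    show d: "degree (w ^ j) = j" by (simp add: w_def degree_power_eq)
    show "coeff (w ^ j) j = 1"
      using lead_coeff_power[of w j] d by (simp add: w_def)
  qed
  have dq: "degree q = n"
    using assms by (simp add: q_def degree_pcompose)
  have cq: "coeff q n = 1"
    using assms lead_coeff_comp[of "[:\<xi>, 1:]" "L n"] dq by (simp add: q_def)
  have "L n = pcompose q w"
    by (simp add: q_def w_def pcompose_assoc[symmetric] pcompose_pCons)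
  also have "\<dots> = (\<Sum>j\<le>n. smult (coeff q j) (w ^ j))"
    using dq by (simp add: pcompose_altdef poly_altdef coeff_map_poly degree_map_poly)
  finally have Ln: "L n = (\<Sum>j\<le>n. smult (coeff q j) (w ^ j))" .
  have "w ^ k * P = (\<Sum>j\<le>n. smult (r n * coeff q j / r j) (w ^ (k + j)))"
    by (simp add: P_def sum_distrib_left power_add)
  then have "(pderiv ^^ k) (w ^ k * P) =
      (\<Sum>j\<le>n. smult (r n * coeff q j / r j) (smult (r j) (w ^ j)))"
    by (simp only: higher_pderiv_sum higher_pderiv_smult w_def higher_pderiv_linear_power r_def)
  also have "\<dots> = smult (r n) (L n)"
    proof -
    have "smult c (\<Sum>j\<in>A. f j) = (\<Sum>j\<in>A. smult c (f j))"
      for c :: complex and A and f :: "nat \<Rightarrow> complex poly"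
      by (induction A rule: infinite_finite_induct) (simp_all add: smult_add_right)
    then show ?thesis
      unfolding Ln by (simp add: r)
  qed
  finally have eq: "(pderiv ^^ k) (w ^ k * P) = smult (r n) (L n)" .
  have "degree P \<le> n"
    unfolding P_def by (intro degree_sum_le) (auto simp: w)
  moreover have "coeff P n = (\<Sum>j\<le>n. if j = n then 1 else 0)"
    unfolding P_def coeff_sum
    by (intro sum.cong) (auto simp: w cq r coeff_eq_0)
  then have "coeff P n \<noteq> 0" by simp
  ultimately have "degree P = n"
    using le_degree by (metis le_antisym)
  with eq show ?thesis
    by (auto simp: is_polar_poly_def w_def r_def)
qed

lemma is_polar_poly_polar_poly:
  assumes "degree (L n) = n" "lead_coeff (L n) = 1"
  shows "is_polar_poly L k \<xi> n (polar_poly L k \<xi> n)"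
  unfolding polar_poly_def
  using is_polar_poly_exists[of L n, OF assms] is_polar_poly_unique by (metis theI)

end

theory Submission
  imports Defs "HOL-Computational_Algebra.Fundamental_Theorem_Algebra"
begin

text \<open>
  Write \<open>w = z - \<xi>\<close> and expand the orthogonal polynomial in powers of \<open>w\<close>, say with
  coefficients \<open>q\<^sub>j\<close>. Since \<open>w ^ (k + j)\<close> has \<open>k\<close>-th derivative \<open>(j + 1) \<cdots> (j + k) w ^ j\<close>, the
  polar polynomial is, up to a constant factor,
  \<open>\<Sum>j\<le>n. q\<^sub>j w ^ j / ((j + 1) \<cdots> (j + k))\<close>. For fixed \<open>w\<close> this is a linear functional of the
  polynomial \<open>q\<close>.

  The zeros of the orthogonal polynomial lie in the closed unit disk, so those of \<open>q\<close> lie in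
  the disk \<open>cball 0 r\<close> with \<open>r = 1 + |\<xi>|\<close>. By the coincidence theorem of Grace, Walsh and Szego
  (\<open>grace_nonvanishing\<close>), a linear functional that is nonzero on every power \<open>(X - \<alpha>) ^ n\<close> with
  \<open>\<alpha>\<close> in the disk is nonzero on every polynomial of degree \<open>n\<close> all of whose zeros lie in the
  disk. It therefore suffices to treat \<open>q = (X - \<alpha>) ^ n\<close>.

  For such a power the functional is, up to a constant, the tail
  \<open>\<Sum>j\<le>n. (n + k choose j + k) w ^ j (-\<alpha>) ^ (n - j)\<close> of a binomial expansion. Rewritten in powers
  of \<open>-\<alpha>\<close> and \<open>w - \<alpha>\<close>, it becomes a homogeneous polynomial with coefficients
  \<open>k - 1 + j choose j\<close> (\<open>binomial_tail_eq\<close>). Consecutive coefficients grow by a factor at most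
  \<open>k\<close>, so the theorem of Enestrom and Kakeya shows that it does not vanish when
  \<open>|w - \<alpha>| > k |\<alpha>|\<close>, which holds as soon as \<open>|w| > (k + 1) r\<close>. Hence each zero \<open>z\<close> satisfies
  \<open>|z - \<xi>| \<le> (k + 1) (1 + |\<xi>|)\<close>.
\<close>

section \<open>Zeros of orthogonal polynomials on the unit circle\<close>

lemma set_integrable_continuous_compact:
  fixes f :: "'a::euclidean_space \<Rightarrow> 'b::{banach, second_countable_topology}"
  assumes "finite_measure M" "sets M = sets borel" "compact S" "continuous_on S f"
  shows "set_integrable M S f"
proof -
  interpret finite_measure M by fact
  have "bounded (f ` S)"
    using assms by (intro compact_imp_bounded compact_continuous_image)
  then obtain B where B: "\<And>x. x \<in> S \<Longrightarrow> norm (f x) \<le> B" "B > 0"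
    unfolding bounded_pos by auto
  have "(\<lambda>x. indicator S x *\<^sub>R f x) \<in> borel_measurable borel"
    using assms by (intro borel_measurable_continuous_on_indicator) (auto intro: borel_compact)
  then have meas: "(\<lambda>x. indicator S x *\<^sub>R f x) \<in> borel_measurable M"
    using assms(2) by (simp cong: measurable_cong_sets)
  show ?thesis
    unfolding set_integrable_def
    by (rule integrable_const_bound[where B = B])
      (use B meas in \<open>auto simp: indicator_def\<close>)
qed

lemma set_integral_sum:
  fixes f :: "'i \<Rightarrow> 'a \<Rightarrow> 'b::{banach, second_countable_topology}"
  assumes "\<And>i. i \<in> I \<Longrightarrow> set_integrable M A (f i)"
  shows "(LINT x:A|M. \<Sum>i\<in>I. f i x) = (\<Sum>i\<in>I. LINT x:A|M. f i x)"
  using assms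
  unfolding set_lebesgue_integral_def set_integrable_def scaleR_sum_right
  by (rule Bochner_Integration.integral_sum)

lemma set_integral_Re:
  assumes "set_integrable M A f"
  shows "(LINT x:A|M. Re (f x)) = Re (LINT x:A|M. f x)"
  using integral_Re[OF assms[unfolded set_integrable_def]]
  by (simp add: set_lebesgue_integral_def)

lemma monic_OPS_orthogonal:
  assumes "circle_measure M" "monic_OPS M L" "degree q < n"
  shows "(LINT z:sphere 0 1|M. poly (L n) z * cnj (poly q z)) = 0"
proof -
  have int: "set_integrable M (sphere 0 1) f" if "continuous_on (sphere 0 1) f"
    for f :: "complex \<Rightarrow> complex"
    using that assms(1) unfolding circle_measure_def
    by (intro set_integrable_continuous_compact) auto
  have meas: "sphere 0 1 \<in> sets M"
    using assms(1) by (auto simp: circle_measure_def)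
  have cnj: "cnj z = inverse z" if "cmod z = 1" for z
    using that by (metis inverse_unique complex_norm_square of_real_1 power_one)
  have "(LINT z:sphere 0 1|M. poly (L n) z * cnj (poly q z)) =
        (LINT z:sphere 0 1|M. \<Sum>j\<le>degree q. cnj (coeff q j) * (poly (L n) z * z powi (- int j)))"
    using meas
    by (intro set_lebesgue_integral_cong)
      (auto simp: poly_altdef sum_distrib_left cnj power_int_minus power_inverse
        mult_ac intro!: sum.cong)
  also have "\<dots> = (\<Sum>j\<le>degree q.
      LINT z:sphere 0 1|M. cnj (coeff q j) * (poly (L n) z * z powi (- int j)))"
    by (intro set_integral_sum int continuous_intros) auto
  also have "\<dots> = 0"
    using assms(2,3) by (intro sum.neutral) (auto simp: monic_OPS_def)
  finally show ?thesis .
qed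

text \<open>
  Divide out a zero, \<open>L = (z - a) q\<close>. On the circle \<open>z q\<close> has the same modulus as \<open>q\<close>, and
  \<open>z q = L + a q\<close> is an orthogonal decomposition because \<open>q\<close> has smaller degree than \<open>L\<close>. So
  Pythagoras gives
  \<open>\<parallel>q\<parallel>\<^sup>2 = \<parallel>L\<parallel>\<^sup>2 + |a|\<^sup>2 \<parallel>q\<parallel>\<^sup>2\<close>.
\<close>

lemma monic_OPS_zeros:
  assumes "circle_measure M" "monic_OPS M L" "poly (L n) a = 0"
  shows "cmod a \<le> 1"
proof -
  let ?S = "sphere (0::complex) 1"
  have int: "set_integrable M ?S f" if "continuous_on ?S f"
    for f :: "complex \<Rightarrow> 'b::{banach, second_countable_topology}"
    using that assms(1) unfolding circle_measure_def
    by (intro set_integrable_continuous_compact) auto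
  have meas: "?S \<in> sets M"
    using assms(1) by (auto simp: circle_measure_def)
  obtain q where q: "L n = [:- a, 1:] * q"
    using assms(3) by (auto simp: poly_eq_0_iff_dvd)
  have L: "degree (L n) = n" "L n \<noteq> 0" "(LINT z:?S|M. (cmod (poly (L n) z))\<^sup>2) \<noteq> 0"
    using assms(2) unfolding monic_OPS_def by (auto, metis coeff_0 zero_neq_one)
  have "q \<noteq> 0"
    using L(2) q by auto
  then have "degree (L n) = Suc (degree q)"
    unfolding q by (subst degree_mult_eq) auto
  then have deg: "degree q < n"
    using L(1) by simp
  define A where "A = (LINT z:?S|M. (cmod (poly q z))\<^sup>2)"
  define B where "B = (LINT z:?S|M. (cmod (poly (L n) z))\<^sup>2)"
  define g where "g z = poly (L n) z * cnj (poly q z)" for z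
  have A: "A \<ge> 0" and B: "B > 0"
    using L(3) unfolding A_def B_def set_lebesgue_integral_def
    by (auto intro!: Bochner_Integration.integral_nonneg simp: less_le)
  have pyth: "(cmod (poly q z))\<^sup>2 =
      (cmod (poly (L n) z))\<^sup>2 + (cmod a)\<^sup>2 * (cmod (poly q z))\<^sup>2 + Re (2 * cnj a * g z)"
    if "z \<in> ?S" for z
  proof -
    have *: "(cmod (u + v))\<^sup>2 = (cmod u)\<^sup>2 + (cmod v)\<^sup>2 + Re (2 * (u * cnj v))" for u v
      unfolding cmod_power2 by (simp add: power2_eq_square algebra_simps)
    have "cmod (poly q z) = cmod (z * poly q z)"
      using that by (simp add: norm_mult)
    also have "z * poly q z = poly (L n) z + a * poly q z"
      by (simp add: q algebra_simps)
    finally have "(cmod (poly q z))\<^sup>2 = (cmod (poly (L n) z + a * poly q z))\<^sup>2"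
      by simp
    also have "\<dots> = (cmod (poly (L n) z))\<^sup>2 + (cmod a)\<^sup>2 * (cmod (poly q z))\<^sup>2
        + Re (2 * cnj a * g z)"
      unfolding * norm_mult power_mult_distrib g_def complex_cnj_mult by (simp only: mult_ac)
    finally show ?thesis .
  qed
  have g0: "(LINT z:?S|M. 2 * cnj a * g z) = 0"
    using monic_OPS_orthogonal[OF assms(1,2) deg] by (simp add: g_def)
  have gRe: "(LINT z:?S|M. Re (2 * cnj a * g z)) = 0"
    by (subst set_integral_Re) (use g0 in \<open>auto simp: g_def intro!: int continuous_intros\<close>)
  have "A = (LINT z:?S|M. (cmod (poly (L n) z))\<^sup>2 + (cmod a)\<^sup>2 * (cmod (poly q z))\<^sup>2
                 + Re (2 * cnj a * g z))"
    unfolding A_def using meas pyth by (intro set_lebesgue_integral_cong) auto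
  also have "\<dots> = (LINT z:?S|M. (cmod (poly (L n) z))\<^sup>2 + (cmod a)\<^sup>2 * (cmod (poly q z))\<^sup>2)
                 + (LINT z:?S|M. Re (2 * cnj a * g z))"
    unfolding g_def by (intro set_integral_add int continuous_intros)
  also have "\<dots> = B + (cmod a)\<^sup>2 * A"
    unfolding gRe B_def A_def
    by (subst set_integral_add) (auto intro!: int continuous_intros)
  finally have "(cmod a)\<^sup>2 * A < 1 * A"
    using B by simp
  then have "(cmod a)\<^sup>2 < 1"
    using A mult_right_less_imp_less by blast
  then show ?thesis
    by (simp add: power_less_one_iff abs_square_less_1)
qed

section \<open>The coincidence theorem of Grace, Walsh and Szego\<close>

text \<open>
  The set consists of the values \<open>1 / (\<alpha> - \<beta>)\<close> with \<open>|\<beta>| > r\<close>, together with \<open>0\<close>, which stands for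
  \<open>\<beta> = \<infinity>\<close>. Expanding the squares shows the role of \<open>|\<alpha>| \<le> r\<close>: the condition reads
  \<open>(r\<^sup>2 - |\<alpha>|\<^sup>2) |x|\<^sup>2 + 2 Re (\<alpha> x) < 1\<close>, and the left-hand side is then a convex function of \<open>x\<close>.
\<close>

lemma convex_inverse_exterior:
  assumes "cmod \<alpha> \<le> r"
  shows "convex {x. r * cmod x < cmod (\<alpha> * x - 1)}"
proof -
  define c where "c = r\<^sup>2 - (cmod \<alpha>)\<^sup>2"
  have r: "r \<ge> 0"
    using assms norm_ge_zero order_trans by blast
  have c: "c \<ge> 0"
    unfolding c_def using assms by (simp add: power_mono)
  have eq: "r * cmod x < cmod (\<alpha> * x - 1) \<longleftrightarrow> c * (cmod x)\<^sup>2 + 2 * Re (\<alpha> * x) < 1" for x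
  proof -
    have "r * cmod x < cmod (\<alpha> * x - 1) \<longleftrightarrow> (r * cmod x)\<^sup>2 < (cmod (\<alpha> * x - 1))\<^sup>2"
      using r by (auto intro: power_strict_mono power2_less_imp_less)
    also have "(cmod (\<alpha> * x - 1))\<^sup>2 = (cmod \<alpha>)\<^sup>2 * (cmod x)\<^sup>2 - 2 * Re (\<alpha> * x) + 1"
      unfolding cmod_power2 by (simp add: power2_eq_square algebra_simps)
    finally show ?thesis
      by (auto simp: c_def power_mult_distrib algebra_simps)
  qed
  show ?thesis
    unfolding eq
  proof (rule convexI, clarify)
    fix x y :: complex and u v :: real
    assume x: "c * (cmod x)\<^sup>2 + 2 * Re (\<alpha> * x) < 1" and y: "c * (cmod y)\<^sup>2 + 2 * Re (\<alpha> * y) < 1"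
      and uv: "0 \<le> u" "0 \<le> v" "u + v = 1"
    have v: "v = 1 - u"
      using uv by simp
    have "u * (cmod x)\<^sup>2 + v * (cmod y)\<^sup>2 - (cmod (u *\<^sub>R x + v *\<^sub>R y))\<^sup>2 = u * v * (cmod (x - y))\<^sup>2"
      unfolding cmod_power2 v by (simp add: power2_eq_square algebra_simps)
    also have "\<dots> \<ge> 0"
      using uv by simp
    finally have "c * (cmod (u *\<^sub>R x + v *\<^sub>R y))\<^sup>2 \<le> c * (u * (cmod x)\<^sup>2 + v * (cmod y)\<^sup>2)"
      using c by (intro mult_left_mono) auto
    moreover have "Re (\<alpha> * (u *\<^sub>R x + v *\<^sub>R y)) = u * Re (\<alpha> * x) + v * Re (\<alpha> * y)"
      by (simp add: algebra_simps)
    ultimately have "c * (cmod (u *\<^sub>R x + v *\<^sub>R y))\<^sup>2 + 2 * Re (\<alpha> * (u *\<^sub>R x + v *\<^sub>R y)) \<le>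
        u * (c * (cmod x)\<^sup>2 + 2 * Re (\<alpha> * x)) + v * (c * (cmod y)\<^sup>2 + 2 * Re (\<alpha> * y))"
      by (simp add: algebra_simps)
    also have "\<dots> < 1"
      using convex_bound_lt[OF x y uv] .
    finally show "c * (cmod (u *\<^sub>R x + v *\<^sub>R y))\<^sup>2 + 2 * Re (\<alpha> * (u *\<^sub>R x + v *\<^sub>R y)) < 1" .
  qed
qed

text \<open>
  The quotient \<open>Q' / Q\<close> at \<open>\<alpha>\<close> is the sum of \<open>1 / (\<alpha> - \<beta>)\<close> over the zeros \<open>\<beta>\<close> of \<open>Q\<close>. Adding
  zeros at infinity until there are \<open>N\<close> of them makes it \<open>N\<close> times an average of points of the
  convex set above.
\<close>

lemma log_derivative_average:
  fixes Q :: "complex poly"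
  assumes "cmod \<alpha> \<le> r" "degree Q \<le> N" "\<And>z. cmod z \<le> r \<Longrightarrow> poly Q z \<noteq> 0"
  shows "\<exists>x. r * cmod x < cmod (\<alpha> * x - 1) \<and> poly (pderiv Q) \<alpha> = of_nat N * x * poly Q \<alpha>"
  using assms(2,3)
proof (induction N arbitrary: Q)
  case 0
  then have "pderiv Q = 0"
    by (simp add: pderiv_eq_0_iff)
  then show ?case
    by (intro exI[of _ 0]) simp
next
  case (Suc N)
  show ?case
  proof (cases "degree Q = 0")
    case True
    then have "pderiv Q = 0"
      by (simp add: pderiv_eq_0_iff)
    then show ?thesis
      by (intro exI[of _ 0]) simp
  next
    case False
    then obtain \<beta> where \<beta>: "poly Q \<beta> = 0"
      using fundamental_theorem_of_algebra[of Q] constant_degree[of Q] by auto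
    then obtain R where R: "Q = [:- \<beta>, 1:] * R"
      by (auto simp: poly_eq_0_iff_dvd)
    have "R \<noteq> 0"
      using False R by auto
    then have "degree Q = Suc (degree R)"
      unfolding R by (subst degree_mult_eq) auto
    then obtain x where x: "r * cmod x < cmod (\<alpha> * x - 1)"
        "poly (pderiv R) \<alpha> = of_nat N * x * poly R \<alpha>"
      using Suc.IH[of R] Suc.prems R by auto
    have \<beta>r: "cmod \<beta> > r"
      using Suc.prems(2) \<beta> not_less by blast
    have ne: "\<alpha> - \<beta> \<noteq> 0"
      using \<beta>r assms(1) by auto
    define y where "y = 1 / (\<alpha> - \<beta>)"
    have y1: "(\<alpha> - \<beta>) * y = 1"
      using ne by (simp add: y_def)
    then have "\<alpha> * y - 1 = \<beta> * y"
      by (simp add: algebra_simps)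
    then have y: "r * cmod y < cmod (\<alpha> * y - 1)"
    proof -
      have "y \<noteq> 0"
        using y1 by auto
      then show ?thesis
        using \<beta>r \<open>\<alpha> * y - 1 = \<beta> * y\<close> by (simp add: norm_mult)
    qed
    define u where "u = 1 / real (Suc N)"
    define v where "v = real N / real (Suc N)"
    have uv: "u \<ge> 0" "v \<ge> 0" "u + v = 1"
      by (auto simp: u_def v_def field_simps)
    have "u *\<^sub>R y + v *\<^sub>R x \<in> {x. r * cmod x < cmod (\<alpha> * x - 1)}"
      using convexD[OF convex_inverse_exterior[OF assms(1)] _ _ uv] x(1) y by auto
    moreover have "of_nat (Suc N) * (u *\<^sub>R y + v *\<^sub>R x) = y + of_nat N * x"
    proof -
      have "of_nat (Suc N) * (u *\<^sub>R y + v *\<^sub>R x) = (real (Suc N) * u) *\<^sub>R y + (real (Suc N) * v) *\<^sub>R x"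
        by (simp add: scaleR_conv_of_real algebra_simps)
      also have "real (Suc N) * u = 1"
        by (simp add: u_def)
      also have "real (Suc N) * v = real N"
        by (simp add: v_def)
      finally show ?thesis
        by (simp add: scaleR_conv_of_real)
    qed
    moreover have "poly (pderiv Q) \<alpha> = (y + of_nat N * x) * poly Q \<alpha>"
    proof -
      have "poly (pderiv Q) \<alpha> = poly R \<alpha> + (\<alpha> - \<beta>) * poly (pderiv R) \<alpha>"
        unfolding R pderiv_mult by (simp add: pderiv_pCons algebra_simps)
      also have "\<dots> = ((\<alpha> - \<beta>) * y) * poly R \<alpha> + (\<alpha> - \<beta>) * (of_nat N * x * poly R \<alpha>)"
        unfolding x(2) y1 by simp
      also have "\<dots> = (y + of_nat N * x) * poly Q \<alpha>"
        unfolding R by (simp add: algebra_simps)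
      finally show ?thesis .
    qed
    ultimately show ?thesis
      by (intro exI[of _ "u *\<^sub>R y + v *\<^sub>R x"]) simp
  qed
qed

text \<open>
  This is the theorem of Laguerre on the polar derivative. If the expression vanished, the
  average from the preceding lemma would be \<open>1 / (\<alpha> - a)\<close>, and so \<open>a\<close> would lie outside the disk.
\<close>

lemma laguerre_polar_derivative:
  fixes Q :: "complex poly"
  assumes "cmod \<alpha> \<le> r" "cmod a \<le> r" "degree Q \<le> N" "N > 0"
    and "\<And>z. cmod z \<le> r \<Longrightarrow> poly Q z \<noteq> 0"
  shows "of_nat N * poly Q \<alpha> + (a - \<alpha>) * poly (pderiv Q) \<alpha> \<noteq> 0"
proof
  assume 0: "of_nat N * poly Q \<alpha> + (a - \<alpha>) * poly (pderiv Q) \<alpha> = 0"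
  obtain x where x: "r * cmod x < cmod (\<alpha> * x - 1)"
      "poly (pderiv Q) \<alpha> = of_nat N * x * poly Q \<alpha>"
    using log_derivative_average[OF assms(1,3,5)] by blast
  have "of_nat N * poly Q \<alpha> * (1 + (a - \<alpha>) * x) = 0"
    using 0 unfolding x(2) by (simp add: algebra_simps)
  then have "1 + (a - \<alpha>) * x = 0"
    using assms(1,4,5) by auto
  then have "\<alpha> * x - 1 = a * x"
    by (simp add: algebra_simps)
  then show False
    using x(1) assms(2) mult_right_mono[OF assms(2), of "cmod x"] by (simp add: norm_mult)
qed

text \<open>
  As a function of \<open>\<alpha>\<close>, \<open>F ((X - \<alpha>) ^ Suc N)\<close> is a polynomial whose derivative is obtained by
  differentiating under \<open>F\<close>. Splitting off one factor \<open>X - \<alpha>\<close> reduces the exponent at the price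
  of the second functional \<open>f \<mapsto> F (X f)\<close>, so the induction runs over all functionals.
\<close>

lemma linear_functional_of_power:
  fixes F :: "complex poly \<Rightarrow> complex"
  assumes "\<And>p q. F (p + q) = F p + F q" "\<And>c p. F (smult c p) = c * F p"
  shows "\<exists>Q. degree Q \<le> Suc N \<and> (\<forall>\<alpha>. poly Q \<alpha> = F ([:- \<alpha>, 1:] ^ Suc N) \<and>
           poly (pderiv Q) \<alpha> = - of_nat (Suc N) * F ([:- \<alpha>, 1:] ^ N))"
  using assms
proof (induction N arbitrary: F)
  case 0
  have "F [:- \<alpha>, 1:] = F [:0, 1:] - \<alpha> * F 1" for \<alpha>
    using "0.prems"(1)[of "[:0, 1:]" "smult (- \<alpha>) 1"] "0.prems"(2)[of "- \<alpha>" 1] by simp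
  then show ?case
    by (intro exI[of _ "[:F [:0, 1:], - F 1:]"]) (simp add: pderiv_pCons)
next
  case (Suc N)
  define G where "G p = F ([:0, 1:] * p)" for p
  have "\<And>p q. G (p + q) = G p + G q" "\<And>c p. G (smult c p) = c * G p"
    unfolding G_def distrib_left mult_smult_right by (rule Suc.prems)+
  then obtain Q where Q: "degree Q \<le> Suc N"
      "\<And>\<alpha>. poly Q \<alpha> = G ([:- \<alpha>, 1:] ^ Suc N)"
      "\<And>\<alpha>. poly (pderiv Q) \<alpha> = - of_nat (Suc N) * G ([:- \<alpha>, 1:] ^ N)"
    using Suc.IH by blast
  obtain R where R: "degree R \<le> Suc N"
      "\<And>\<alpha>. poly R \<alpha> = F ([:- \<alpha>, 1:] ^ Suc N)"
      "\<And>\<alpha>. poly (pderiv R) \<alpha> = - of_nat (Suc N) * F ([:- \<alpha>, 1:] ^ N)"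
    using Suc.IH[OF Suc.prems] by blast
  have step: "F ([:- \<alpha>, 1:] ^ Suc m) = G ([:- \<alpha>, 1:] ^ m) - \<alpha> * F ([:- \<alpha>, 1:] ^ m)" for \<alpha> m
  proof -
    have "[:- \<alpha>, 1:] ^ Suc m = [:0, 1:] * [:- \<alpha>, 1:] ^ m + smult (- \<alpha>) ([:- \<alpha>, 1:] ^ m)"
      by (simp add: algebra_simps)
    then show ?thesis
      by (simp only: G_def Suc.prems) simp
  qed
  show ?case
  proof (intro exI[of _ "Q - [:0, 1:] * R"] conjI allI)
    show "degree (Q - [:0, 1:] * R) \<le> Suc (Suc N)"
    proof (rule degree_diff_le)
      show "degree ([:0, 1:] * R) \<le> Suc (Suc N)"
        using R(1) by (intro order_trans[OF degree_mult_le]) simp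
    qed (use Q(1) in simp)
    fix \<alpha>
    show "poly (Q - [:0, 1:] * R) \<alpha> = F ([:- \<alpha>, 1:] ^ Suc (Suc N))"
      unfolding step[of \<alpha> "Suc N"] by (simp add: Q(2) R(2) del: power_Suc)
    have "poly (pderiv (Q - [:0, 1:] * R)) \<alpha> =
        - of_nat (Suc N) * (G ([:- \<alpha>, 1:] ^ N) - \<alpha> * F ([:- \<alpha>, 1:] ^ N)) - F ([:- \<alpha>, 1:] ^ Suc N)"
      unfolding pderiv_diff pderiv_mult
      by (simp add: pderiv_pCons Q(3) R(2,3) algebra_simps del: power_Suc)
    then show "poly (pderiv (Q - [:0, 1:] * R)) \<alpha> =
        - of_nat (Suc (Suc N)) * F ([:- \<alpha>, 1:] ^ Suc N)"
      unfolding step[of \<alpha> N, symmetric] by (simp add: algebra_simps del: power_Suc)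
  qed
qed

text \<open>
  One zero at a time is split off and absorbed into the functional: if \<open>a\<close> is a zero of \<open>p\<close>,
  pass to \<open>f \<mapsto> F ((X - a) f)\<close>. Its values on the powers \<open>(X - \<alpha>) ^ N\<close> are a polar derivative of
  the polynomial \<open>\<alpha> \<mapsto> F ((X - \<alpha>) ^ Suc N)\<close>, so they are nonzero by the theorem of Laguerre.
\<close>

theorem grace_nonvanishing:
  fixes F :: "complex poly \<Rightarrow> complex"
  assumes "\<And>p q. F (p + q) = F p + F q" "\<And>c p. F (smult c p) = c * F p"
    and "\<And>\<alpha>. cmod \<alpha> \<le> r \<Longrightarrow> F ([:- \<alpha>, 1:] ^ N) \<noteq> 0"
    and "0 \<le> r" "p \<noteq> 0" "degree p = N" "\<And>z. poly p z = 0 \<Longrightarrow> cmod z \<le> r"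
  shows "F p \<noteq> 0"
  using assms
proof (induction N arbitrary: F p)
  case 0
  obtain c where c: "p = smult c 1"
    using "0.prems"(6) by (metis degree_eq_zeroE smult_one)
  show ?case
    using "0.prems"(3)[of 0] "0.prems"(4,5) unfolding c "0.prems"(2) by simp
next
  case (Suc N)
  obtain a where a: "poly p a = 0"
    using fundamental_theorem_of_algebra[of p] constant_degree[of p] Suc.prems(6) by auto
  then obtain q where q: "p = [:- a, 1:] * q"
    by (auto simp: poly_eq_0_iff_dvd)
  have ar: "cmod a \<le> r"
    using Suc.prems(7) a by blast
  have q0: "q \<noteq> 0"
    using q Suc.prems(5) by auto
  then have "degree p = Suc (degree q)"
    unfolding q by (subst degree_mult_eq) auto
  then have dq: "degree q = N"
    using Suc.prems(6) by simp
  obtain Q where Q: "degree Q \<le> Suc N" "\<And>\<alpha>. poly Q \<alpha> = F ([:- \<alpha>, 1:] ^ Suc N)"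
      "\<And>\<alpha>. poly (pderiv Q) \<alpha> = - of_nat (Suc N) * F ([:- \<alpha>, 1:] ^ N)"
    using linear_functional_of_power[of F N, OF Suc.prems(1,2)] by blast
  define G where "G f = F ([:- a, 1:] * f)" for f
  have "G q \<noteq> 0"
  proof (rule Suc.IH)
    show "G (f + g) = G f + G g" for f g
      unfolding G_def distrib_left by (rule Suc.prems(1))
    show "G (smult c f) = c * G f" for c f
      unfolding G_def mult_smult_right by (rule Suc.prems(2))
    show "G ([:- \<alpha>, 1:] ^ N) \<noteq> 0" if "cmod \<alpha> \<le> r" for \<alpha>
    proof -
      have "[:- a, 1:] * [:- \<alpha>, 1:] ^ N = [:- \<alpha>, 1:] ^ Suc N + smult (\<alpha> - a) ([:- \<alpha>, 1:] ^ N)"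
        by (simp add: algebra_simps smult_diff_left)
      then have "G ([:- \<alpha>, 1:] ^ N) = poly Q \<alpha> + (\<alpha> - a) * F ([:- \<alpha>, 1:] ^ N)"
        by (simp only: G_def Suc.prems(1,2) Q(2))
      then have "of_nat (Suc N) * G ([:- \<alpha>, 1:] ^ N) =
          of_nat (Suc N) * poly Q \<alpha> + (a - \<alpha>) * poly (pderiv Q) \<alpha>"
        unfolding Q(3) by (simp only: ring_distribs minus_mult_left[symmetric] mult_ac) simp
      also have "\<dots> \<noteq> 0"
        by (rule laguerre_polar_derivative[OF that ar Q(1)]) (use Suc.prems(3) Q(2) in auto)
      finally show ?thesis
        by auto
    qed
    show "cmod z \<le> r" if "poly q z = 0" for z
      using Suc.prems(7)[of z] that by (simp add: q)
  qed (use Suc.prems(4) q0 dq in auto)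
  then show ?case
    by (simp add: G_def q)
qed

section \<open>Tails of binomial expansions\<close>

text \<open>
  Multiplying by \<open>1 - y\<close> telescopes the sum into \<open>d 0\<close> minus a combination of positive powers of
  \<open>y\<close> with nonnegative coefficients of total \<open>d 0\<close>; this has modulus less than \<open>d 0\<close>.
\<close>

lemma enestrom_kakeya:
  fixes d :: "nat \<Rightarrow> real" and y :: complex
  assumes "\<And>j. d (Suc j) \<le> d j" "\<And>j. 0 \<le> d j" "0 < d 0" "cmod y < 1"
  shows "(\<Sum>j\<le>n. of_real (d j) * y ^ j) \<noteq> 0"
proof
  assume 0: "(\<Sum>j\<le>n. of_real (d j) * y ^ j) = 0"
  have pow: "cmod y ^ Suc m \<le> cmod y" for m
    using assms(4) by (simp add: mult_left_le power_le_one)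
  define E where "E m = (1 - y) * (\<Sum>j\<le>m. of_real (d j) * y ^ j) - of_real (d 0)
      + of_real (d m) * y ^ Suc m" for m
  have "cmod (E m) \<le> cmod y * (d 0 - d m)" for m
  proof (induction m)
    case (Suc m)
    have "E (Suc m) = E m - of_real (d m - d (Suc m)) * y ^ Suc m"
      by (simp add: E_def algebra_simps)
    then have "cmod (E (Suc m)) \<le> cmod (E m) + cmod (of_real (d m - d (Suc m)) * y ^ Suc m)"
      by (metis norm_triangle_ineq4)
    also have "cmod (of_real (d m - d (Suc m)) * y ^ Suc m) = (d m - d (Suc m)) * cmod y ^ Suc m"
      unfolding norm_mult norm_power norm_of_real using assms(1)[of m] by simp
    also have "\<dots> \<le> (d m - d (Suc m)) * cmod y"
      using assms(1)[of m] pow[of m] by (intro mult_left_mono) auto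
    finally show ?case
      using Suc.IH by (simp add: algebra_simps)
  qed (simp add: E_def algebra_simps)
  then have "cmod (E n) \<le> cmod y * (d 0 - d n)" .
  define T where "T = of_real (d n) * y ^ Suc n"
  have "of_real (d 0) = T - E n"
    unfolding E_def T_def 0 by simp
  then have "cmod (of_real (d 0)) \<le> cmod T + cmod (E n)"
    by (metis norm_triangle_ineq4)
  also have "cmod T \<le> cmod y * d n"
    unfolding T_def norm_mult norm_power norm_of_real mult.commute[of "cmod y"]
    using assms(2)[of n] pow[of n] by (simp only: abs_of_nonneg mult_left_mono)
  also have "cmod (E n) \<le> cmod y * (d 0 - d n)"
    by fact
  finally have "cmod (of_real (d 0)) \<le> cmod y * d 0"
    by (simp only: right_diff_distrib) simp
  then show False
    using assms(3,4) by simp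
qed

text \<open>
  Multiplying the tail for \<open>n\<close> by \<open>w + a\<close> gives, by the rule of Pascal, the tail for \<open>Suc n\<close>
  except that a contribution \<open>Suc n + m choose m\<close> to the coefficient of \<open>a ^ Suc n\<close> is missing.
  The right-hand side satisfies the same recursion in \<open>n\<close>.
\<close>

lemma binomial_tail_eq:
  fixes w a :: "'a::comm_ring_1"
  shows "(\<Sum>j\<le>n. of_nat (n + Suc m choose (j + Suc m)) * w ^ j * a ^ (n - j)) =
         (\<Sum>j\<le>n. of_nat (m + j choose j) * (w + a) ^ (n - j) * a ^ j)"
proof (induction n)
  case (Suc n)
  define c where "c j = (of_nat (n + Suc m choose (j + Suc m)) :: 'a)" for j
  have pascal: "of_nat (Suc n + Suc m choose (Suc j + Suc m)) = c j + c (Suc j)" for j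
    by (simp add: c_def)
  have pascal0: "of_nat (Suc n + Suc m choose (0 + Suc m)) =
      of_nat (m + Suc n choose Suc n) + c 0"
  proof -
    have "(Suc (n + m) choose m) = (Suc (n + m) choose Suc n)"
      by (subst binomial_symmetric) (auto intro: arg_cong2[where f = "(choose)"])
    then show ?thesis
      by (simp add: c_def add_ac)
  qed
  have c0: "c (Suc n) = 0"
    by (simp add: c_def binomial_eq_0 del: binomial_Suc_Suc)
  have "(\<Sum>j\<le>Suc n. of_nat (Suc n + Suc m choose (j + Suc m)) * w ^ j * a ^ (Suc n - j)) =
      (of_nat (m + Suc n choose Suc n) + c 0) * a ^ Suc n
      + (\<Sum>j\<le>n. (c j + c (Suc j)) * w ^ Suc j * a ^ (n - j))"
    unfolding sum.atMost_Suc_shift pascal pascal0 by simp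
  also have "\<dots> = of_nat (m + Suc n choose Suc n) * a ^ Suc n
      + (\<Sum>j\<le>n. c j * w ^ Suc j * a ^ (n - j))
      + (c 0 * a ^ Suc n + (\<Sum>j\<le>n. c (Suc j) * w ^ Suc j * a ^ (n - j)))"
    by (simp add: sum.distrib algebra_simps)
  also have "c 0 * a ^ Suc n + (\<Sum>j\<le>n. c (Suc j) * w ^ Suc j * a ^ (n - j)) =
      (\<Sum>j\<le>Suc n. c j * w ^ j * a ^ (Suc n - j))"
    unfolding sum.atMost_Suc_shift by simp
  also have "\<dots> = (\<Sum>j\<le>n. c j * w ^ j * a ^ (Suc n - j))"
    by (simp add: c0)
  also have "\<dots> = a * (\<Sum>j\<le>n. c j * w ^ j * a ^ (n - j))"
    unfolding sum_distrib_left by (intro sum.cong) (auto simp: Suc_diff_le mult_ac)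
  also have "(\<Sum>j\<le>n. c j * w ^ Suc j * a ^ (n - j)) = w * (\<Sum>j\<le>n. c j * w ^ j * a ^ (n - j))"
    unfolding sum_distrib_left by (intro sum.cong) (auto simp: mult_ac)
  finally have "(\<Sum>j\<le>Suc n. of_nat (Suc n + Suc m choose (j + Suc m)) * w ^ j * a ^ (Suc n - j)) =
      (w + a) * (\<Sum>j\<le>n. c j * w ^ j * a ^ (n - j)) + of_nat (m + Suc n choose Suc n) * a ^ Suc n"
    by (simp add: algebra_simps)
  also have "(\<Sum>j\<le>n. c j * w ^ j * a ^ (n - j)) =
      (\<Sum>j\<le>n. of_nat (m + j choose j) * (w + a) ^ (n - j) * a ^ j)"
    unfolding c_def by (rule Suc.IH)
  also have "(w + a) * \<dots> = (\<Sum>j\<le>n. of_nat (m + j choose j) * (w + a) ^ (Suc n - j) * a ^ j)"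
    unfolding sum_distrib_left by (intro sum.cong) (auto simp: Suc_diff_le mult_ac)
  finally show ?case
    by simp
qed simp

lemma binomial_tail_nonzero:
  fixes w a :: complex
  assumes "0 < k" "(real k + 1) * cmod a < cmod w"
  shows "(\<Sum>j\<le>n. of_nat (n + k choose (j + k)) * w ^ j * a ^ (n - j)) \<noteq> 0"
proof -
  obtain m where k: "k = Suc m"
    using assms(1) gr0_implies_Suc by blast
  define b where "b = w + a"
  have "cmod w \<le> cmod b + cmod a"
    unfolding b_def by (metis add_diff_cancel_right' norm_triangle_ineq4)
  then have b: "real k * cmod a < cmod b"
    using assms(2) by (simp add: algebra_simps)
  then have b0: "b \<noteq> 0"
    by (metis mult_nonneg_nonneg norm_ge_zero norm_zero not_less of_nat_0_le_iff)
  \<comment> \<open>Division by \<open>k ^ j\<close> makes the coefficients decreasing; the variable absorbs this factor.\<close>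
  define y where "y = of_nat k * a / b"
  define d where "d j = real (m + j choose j) / real k ^ j" for j
  have "(\<Sum>j\<le>n. of_real (d j) * y ^ j) \<noteq> 0"
  proof (rule enestrom_kakeya)
    show "d (Suc j) \<le> d j" for j
    proof -
      have "Suc j * (m + Suc j choose Suc j) = (m + Suc j) * (m + j choose j)"
        using Suc_times_binomial_eq[of "m + j" j] by simp
      also have "\<dots> \<le> (Suc j * k) * (m + j choose j)"
        by (intro mult_right_mono) (auto simp: k)
      finally have "(m + Suc j choose Suc j) \<le> k * (m + j choose j)"
        by (simp only: mult.assoc Suc_mult_le_cancel1)
      then have "real (m + Suc j choose Suc j) \<le> real k * real (m + j choose j)"
        unfolding of_nat_mult[symmetric] of_nat_le_iff .
      then have "d (Suc j) \<le> (real k * real (m + j choose j)) / real k ^ Suc j"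
        unfolding d_def by (intro divide_right_mono) auto
      also have "\<dots> = d j"
        using assms(1) by (simp add: d_def)
      finally show ?thesis .
    qed
    show "cmod y < 1"
      using b b0 by (simp add: y_def norm_divide norm_mult)
  qed (auto simp: d_def)
  moreover have "(\<Sum>j\<le>n. of_nat (m + j choose j) * b ^ (n - j) * a ^ j) =
      b ^ n * (\<Sum>j\<le>n. of_real (d j) * y ^ j)"
    unfolding sum_distrib_left
  proof (intro sum.cong refl)
    fix j assume "j \<in> {..n}"
    then have "b ^ n = b ^ (n - j) * b ^ j"
      by (simp add: power_add[symmetric])
    then show "of_nat (m + j choose j) * b ^ (n - j) * a ^ j = b ^ n * (of_real (d j) * y ^ j)"
      using b0 assms(1) by (simp add: d_def y_def power_divide power_mult_distrib)
  qed
  ultimately show ?thesis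
    using b0 unfolding k binomial_tail_eq b_def[symmetric] by simp
qed

section \<open>Zeros of polar polynomials\<close>

lemma binomial_divide_pochhammer:
  assumes "j \<le> n"
  shows "of_nat (n choose j) / pochhammer (of_nat (Suc j)) k =
         (of_nat (n + k choose (j + k)) / pochhammer (of_nat (Suc n)) k :: 'a::field_char_0)"
proof -
  have poch: "pochhammer (of_nat (Suc i)) k = (fact (i + k) / fact i :: 'a)" for i
    using pochhammer_product'[of "1 :: 'a" i k] fact_nonzero[of i, where 'a = 'a]
    by (simp add: pochhammer_fact[symmetric] field_simps)
  show ?thesis
    using assms unfolding poch
    by (simp add: binomial_fact field_simps)
qed

lemma coeff_linear_power_complex:
  assumes "j \<le> n"
  shows "coeff ([:- \<alpha>, 1:] ^ n) j = of_nat (n choose j) * (- \<alpha> :: complex) ^ (n - j)"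
  using assms by (simp add: coeff_linear_poly_power)

text \<open>
  Shifting \<open>\<xi>\<close> to the origin turns the differential equation into a relation between
  coefficients.
\<close>

lemma is_polar_poly_shifted_coeff:
  assumes "is_polar_poly L k \<xi> n P"
  shows "pochhammer (of_nat (Suc j)) k * coeff (pcompose P [:\<xi>, 1:]) j =
         pochhammer (of_nat (Suc n)) k * coeff (pcompose (L n) [:\<xi>, 1:]) j"
proof -
  have shift: "pcompose ((pderiv ^^ k) f) [:\<xi>, 1:] = (pderiv ^^ k) (pcompose f [:\<xi>, 1:])" for f
  proof (induction k)
    case (Suc k)
    have "pcompose (pderiv g) [:\<xi>, 1:] = pderiv (pcompose g [:\<xi>, 1:])" for g
      by (simp add: pderiv_pcompose pderiv_pCons)
    then show ?case
      using Suc by simp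
  qed simp
  have r: "(\<Prod>i=1..k. of_nat (n + i)) = (pochhammer (of_nat (Suc n)) k :: complex)"
    unfolding pochhammer_prod by (rule prod.reindex_bij_witness[of _ Suc "\<lambda>i. i - 1"]) auto
  have "pcompose ([:- \<xi>, 1:] ^ k * P) [:\<xi>, 1:] = monom 1 k * pcompose P [:\<xi>, 1:]"
    using pcompose_prod[of "\<lambda>_. [:- \<xi>, 1:]" "{..<k}" "[:\<xi>, 1:]"]
    by (simp add: pcompose_mult pcompose_pCons monom_altdef)
  then have "(pderiv ^^ k) (monom 1 k * pcompose P [:\<xi>, 1:]) =
      smult (pochhammer (of_nat (Suc n)) k) (pcompose (L n) [:\<xi>, 1:])"
    using assms shift[of "[:- \<xi>, 1:] ^ k * P"]
    unfolding is_polar_poly_def r by (simp add: pcompose_smult)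
  from arg_cong[OF this, of "\<lambda>f. coeff f j"] show ?thesis
    by (simp add: coeff_higher_pderiv coeff_monom_mult add_ac)
qed

theorem is_polar_poly_zeros:
  assumes "is_polar_poly L k \<xi> n P" "degree (L n) = n" "L n \<noteq> 0" "0 < k"
    and "\<And>\<zeta>. poly (L n) \<zeta> = 0 \<Longrightarrow> cmod (\<zeta> - \<xi>) \<le> r" "0 \<le> r"
    and "poly P z = 0"
  shows "cmod (z - \<xi>) \<le> (real k + 1) * r"
proof (rule ccontr)
  define w where "w = z - \<xi>"
  assume "\<not> ?thesis"
  then have w: "(real k + 1) * r < cmod w"
    by (simp add: w_def)
  define q where "q = pcompose (L n) [:\<xi>, 1:]"
  define R where "R i = (pochhammer (of_nat (Suc i)) k :: complex)" for i
  define F where "F p = (\<Sum>j\<le>n. coeff p j * w ^ j / R j)" for p :: "complex poly"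
  have R: "R i \<noteq> 0" for i
    unfolding R_def by (simp add: pochhammer_of_nat del: of_nat_Suc)
      (metis less_irrefl pochhammer_pos zero_less_Suc)
  have "F q \<noteq> 0"
  proof (rule grace_nonvanishing[where r = r and N = n])
    show "F (p + q) = F p + F q" for p q
      by (simp add: F_def sum.distrib[symmetric] algebra_simps add_divide_distrib)
    show "F (smult c p) = c * F p" for c p
      by (simp add: F_def sum_distrib_left mult_ac)
    show "F ([:- \<alpha>, 1:] ^ n) \<noteq> 0" if "cmod \<alpha> \<le> r" for \<alpha>
    proof -
      have "F ([:- \<alpha>, 1:] ^ n) =
          (\<Sum>j\<le>n. (of_nat (n choose j) / R j) * (w ^ j * (- \<alpha>) ^ (n - j)))"
        unfolding F_def by (intro sum.cong) (simp_all add: coeff_linear_power_complex)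
      also have "\<dots> = (\<Sum>j\<le>n. (of_nat (n + k choose (j + k)) / R n) * (w ^ j * (- \<alpha>) ^ (n - j)))"
        unfolding R_def by (intro sum.cong) (simp_all add: binomial_divide_pochhammer del: of_nat_Suc)
      also have "\<dots> = (\<Sum>j\<le>n. of_nat (n + k choose (j + k)) * w ^ j * (- \<alpha>) ^ (n - j)) / R n"
        unfolding sum_divide_distrib by (intro sum.cong) (simp_all add: mult_ac)
      also have "\<dots> \<noteq> 0"
      proof -
        have "(real k + 1) * cmod (- \<alpha>) \<le> (real k + 1) * r"
          using that by (intro mult_left_mono) auto
        then have "(real k + 1) * cmod (- \<alpha>) < cmod w"
          using w by linarith
        from binomial_tail_nonzero[OF assms(4) this, of n] show ?thesis
          using R by simp
      qed
      finally show ?thesis .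
    qed
    show "degree q = n"
      using assms(2) by (simp add: q_def degree_pcompose)
    show "q \<noteq> 0"
      using assms(3) by (simp add: q_def pcompose_eq_0_iff)
    show "cmod \<zeta> \<le> r" if "poly q \<zeta> = 0" for \<zeta>
      using assms(5)[of "\<xi> + \<zeta>"] that by (simp add: q_def poly_pcompose)
  qed fact
  define p where "p = pcompose P [:\<xi>, 1:]"
  have "degree p = n"
    using assms(1) by (simp add: p_def degree_pcompose is_polar_poly_def)
  have cp: "coeff p j = R n * (coeff q j / R j)" for j
    using is_polar_poly_shifted_coeff[OF assms(1), of j] R[of j]
    by (simp add: p_def q_def R_def field_simps)
  have "poly P z = poly p w"
    by (simp add: p_def w_def poly_pcompose)
  also have "\<dots> = R n * F q"
    unfolding poly_altdef \<open>degree p = n\<close> F_def cp sum_distrib_left by (simp add: mult_ac)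
  finally show False
    using \<open>F q \<noteq> 0\<close> R assms(7) by simp
qed

theorem theorem3p2:
  fixes M :: "complex measure" and L :: "nat \<Rightarrow> complex poly" and \<xi> :: complex and k n :: nat
  assumes "circle_measure M"
    and "infinite (msupport M)"
    and "monic_OPS M L"
    and "0 < k"
  shows "{z. poly (polar_poly L k \<xi> n) z = 0}
           \<subseteq> cball 0 (cmod \<xi> + (real k + 1) * (1 + cmod \<xi>))"
proof
  fix z assume "z \<in> {z. poly (polar_poly L k \<xi> n) z = 0}"
  then have z: "poly (polar_poly L k \<xi> n) z = 0"
    by simp
  have L: "degree (L n) = n" "lead_coeff (L n) = 1"
    using assms(3) unfolding monic_OPS_def by blast+
  then have L0: "L n \<noteq> 0"
    by auto
  have "cmod (z - \<xi>) \<le> (real k + 1) * (1 + cmod \<xi>)"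
  proof (rule is_polar_poly_zeros[OF is_polar_poly_polar_poly[of L n, OF L] L(1) L0 assms(4) _ _ z])
    fix \<zeta> assume "poly (L n) \<zeta> = 0"
    then have "cmod \<zeta> \<le> 1"
      by (rule monic_OPS_zeros[OF assms(1,3)])
    then show "cmod (\<zeta> - \<xi>) \<le> 1 + cmod \<xi>"
      using norm_triangle_ineq4[of \<zeta> \<xi>] by linarith
  qed simp
  moreover have "cmod z \<le> cmod (z - \<xi>) + cmod \<xi>"
    by (metis diff_add_cancel norm_triangle_ineq)
  ultimately show "z \<in> cball 0 (cmod \<xi> + (real k + 1) * (1 + cmod \<xi>))"
    by simp
qed

end
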